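(* Let $X$ be a set and let $b: X\times X\to [-\infty,+\infty)$ be a kernel. The following properties are equivalent: (i) $b$ is a tropical positive semidefinite (tpsd) kernel; (ii) there exist a set $Z$ and a function $\psi: X\times Z\to[-\infty,+\infty)$ such that $$b(x,y)=\sup_{z\in Z}\ \psi(x,z)+\psi(y,z)\qquad\text{for all } x,y\in X.$$
   Context: A kernel $b:X\times X\to[-\infty,+\infty)$ is called tropical positive semidefinite (tpsd) if it is symmetric, i.e. $b(x,y)=b(y,x)$ for all $x,y\in X$, and tropically positive, i.e. $b(x,x)+b(y,y)\ge b(x,y)+b(y,x)$ for all $x,y\in X$. Sums in $[-\infty,+\infty)$ equal $-\infty$ as soon as one of the terms is $-\infty$. *)

theory Defs
  imports "HOL-Library.Extended_Real" "HOL-Library.FuncSet"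
begin

text \<open>
  The half-line \<open>[-\<infinity>, +\<infinity>)\<close> is the subset \<open>{..<\<infinity>}\<close> of \<^typ>\<open>ereal\<close>. On this subset the addition
  of \<^typ>\<open>ereal\<close> has \<open>-\<infinity>\<close> as absorbing element (the convention \<open>\<infinity> + -\<infinity> = \<infinity>\<close> is never used).
\<close>

definition kernel_on :: "'a set \<Rightarrow> ('a \<times> 'a \<Rightarrow> ereal) \<Rightarrow> bool" where
  "kernel_on X b \<longleftrightarrow> b \<in> X \<times> X \<rightarrow> {..<\<infinity>}"

definition tropically_positive_on :: "'a set \<Rightarrow> ('a \<times> 'a \<Rightarrow> ereal) \<Rightarrow> bool" where
  "tropically_positive_on X b \<longleftrightarrow> (\<forall>x\<in>X. \<forall>y\<in>X. b (x, x) + b (y, y) \<ge> b (x, y) + b (y, x))"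

definition tpsd_on :: "'a set \<Rightarrow> ('a \<times> 'a \<Rightarrow> ereal) \<Rightarrow> bool" where
  "tpsd_on X b \<longleftrightarrow> kernel_on X b \<and> (\<forall>x\<in>X. \<forall>y\<in>X. b (x, y) = b (y, x)) \<and> tropically_positive_on X b"

text \<open>
  The supremum is taken in \<^typ>\<open>ereal\<close>, so it is \<open>-\<infinity>\<close> when \<open>Z\<close> is empty, and it may a priori be \<open>\<infinity>\<close>;
  for a kernel \<open>b\<close> the equation itself forces it to be \<open>< \<infinity>\<close>.
\<close>

definition tropical_factorization ::
    "'a set \<Rightarrow> ('a \<times> 'a \<Rightarrow> ereal) \<Rightarrow> 'z set \<Rightarrow> ('a \<times> 'z \<Rightarrow> ereal) \<Rightarrow> bool" where
  "tropical_factorization X b Z \<psi> \<longleftrightarrow>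
     \<psi> \<in> X \<times> Z \<rightarrow> {..<\<infinity>} \<and>
     (\<forall>x\<in>X. \<forall>y\<in>X. b (x, y) = (SUP z\<in>Z. \<psi> (x, z) + \<psi> (y, z)))"

end

theory Submission
  imports Defs
begin

text \<open>
  For a symmetric kernel, tropical positivity says that every value \<open>b (x, y)\<close> is at most the mean
  of the two diagonal values \<open>b (x, x)\<close> and \<open>b (y, y)\<close>.

  A factorization forces this inequality because each summand \<open>\<psi> (x, z) + \<psi> (y, z)\<close> is already
  the mean of \<open>2 \<psi> (x, z) \<le> b (x, x)\<close> and \<open>2 \<psi> (y, z) \<le> b (y, y)\<close>, and the mean is a bound that
  does not depend on \<open>z\<close> (\<open>tpsd_on_if_tropical_factorization\<close>).

  Conversely, a tpsd kernel is the supremum of tropical rank-one kernels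
  \<open>(x, y) \<mapsto> \<phi> x + \<phi> y\<close>, one for each pair \<open>(u, v)\<close> with \<open>b (u, v)\<close> finite. Its function \<open>\<phi>\<close>
  lives on the two points \<open>u\<close> and \<open>v\<close>, so it has to meet only finitely many conditions: it must
  reach \<open>b\<close> at \<open>(u, v)\<close> and stay below \<open>b\<close> at the two diagonal points. The first condition together
  with equality at \<open>(u, u)\<close> determines \<open>\<phi>\<close>, and the remaining inequality at \<open>(v, v)\<close> is exactly
  tropical positivity (\<open>tropical_factorization_two_point_factor\<close>).
\<close>

text \<open>
  Halving turns a bound on \<open>a + a\<close> into a bound on \<open>a\<close> itself; in the latter form it passes from
  the summands of a factorization to their supremum.
\<close>

lemma ereal_add_self_le_iff:
  fixes a c :: ereal
  shows "a + a \<le> c \<longleftrightarrow> a \<le> c / 2"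
  by (cases a; cases c) (auto simp: field_simps)

lemma tpsd_on_if_tropical_factorization:
  assumes b: "kernel_on X b" and fac: "tropical_factorization X b Z \<psi>"
  shows "tpsd_on X b"
proof -
  have b_eq: "b (x, y) = (SUP z\<in>Z. \<psi> (x, z) + \<psi> (y, z))" if "x \<in> X" "y \<in> X" for x y
    using fac that by (auto simp: tropical_factorization_def)
  have sym: "b (x, y) = b (y, x)" if "x \<in> X" "y \<in> X" for x y
    using that by (simp add: b_eq add.commute)
  have pos: "b (x, y) + b (y, x) \<le> b (x, x) + b (y, y)" if xy: "x \<in> X" "y \<in> X" for x y
  proof -
    have "b (x, y) \<le> (b (x, x) + b (y, y)) / 2"
      unfolding b_eq[OF xy]
    proof (rule SUP_least)
      fix z assume z: "z \<in> Z"
      have "\<psi> (w, z) + \<psi> (w, z) \<le> b (w, w)" if "w \<in> X" for w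
        unfolding b_eq[OF that that] using z by (rule SUP_upper)
      then have "(\<psi> (x, z) + \<psi> (x, z)) + (\<psi> (y, z) + \<psi> (y, z)) \<le> b (x, x) + b (y, y)"
        using xy by (intro add_mono)
      then show "\<psi> (x, z) + \<psi> (y, z) \<le> (b (x, x) + b (y, y)) / 2"
        unfolding ereal_add_self_le_iff[symmetric] by (simp add: ac_simps)
    qed
    then show ?thesis
      unfolding sym[OF xy, symmetric] ereal_add_self_le_iff .
  qed
  show ?thesis
    unfolding tpsd_on_def tropically_positive_on_def using b sym pos by blast
qed

text \<open>
  The rank-one factor attached to \<open>(u, v)\<close> takes the values \<open>b (u, u) / 2\<close> at \<open>u\<close> and
  \<open>b (u, v) - b (u, u) / 2\<close> at \<open>v\<close>. They agree when \<open>u = v\<close> and \<open>b (u, u)\<close> is finite, so the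
  order of the case distinction is immaterial for the pairs that index the factorization.
\<close>

definition two_point_factor :: "('a \<times> 'a \<Rightarrow> ereal) \<Rightarrow> 'a \<times> ('a \<times> 'a) \<Rightarrow> ereal" where
  "two_point_factor b = (\<lambda>(x, (u, v)).
     if x = u then b (u, u) / 2
     else if x = v then b (u, v) - b (u, u) / 2
     else -\<infinity>)"

text \<open>
  Positivity has a second effect besides the inequality at \<open>(v, v)\<close>: it makes \<open>b (u, u)\<close> and
  \<open>b (v, v)\<close> finite whenever \<open>b (u, v)\<close> is, so that the subtraction in the factor is one of real
  numbers.
\<close>

lemma tropical_factorization_two_point_factor:
  assumes tpsd: "tpsd_on X b"
  shows "tropical_factorization X b {(u, v). u \<in> X \<and> v \<in> X \<and> b (u, v) \<noteq> -\<infinity>} (two_point_factor b)"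
    (is "tropical_factorization X b ?Z ?\<psi>")
proof -
  have lt: "b (x, y) \<noteq> \<infinity>" if "x \<in> X" "y \<in> X" for x y
    using tpsd that unfolding tpsd_on_def kernel_on_def Pi_iff by fastforce
  have sym: "b (x, y) = b (y, x)" if "x \<in> X" "y \<in> X" for x y
    using tpsd that unfolding tpsd_on_def by blast
  have pos: "b (x, y) + b (x, y) \<le> b (x, x) + b (y, y)" if "x \<in> X" "y \<in> X" for x y
    using tpsd that sym[OF that] unfolding tpsd_on_def tropically_positive_on_def by metis
  have real: "\<exists>p q r. b (u, u) = ereal p \<and> b (v, v) = ereal q \<and> b (u, v) = ereal r \<and> 2 * r \<le> p + q"
    if "(u, v) \<in> ?Z" for u v
    using that lt[of u v] lt[of u u] lt[of v v] pos[of u v]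
    by (cases "b (u, u)"; cases "b (v, v)"; cases "b (u, v)") auto
  have fin: "?\<psi> (x, z) < \<infinity>" if "z \<in> ?Z" for x z
  proof -
    obtain u v where z: "z = (u, v)" by fastforce
    show ?thesis
      using real[of u v] that unfolding z by (auto simp: two_point_factor_def)
  qed
  have below: "?\<psi> (x, z) + ?\<psi> (y, z) \<le> b (x, y)" if zZ: "z \<in> ?Z" for x y z
  proof -
    obtain u v where z: "z = (u, v)" by fastforce
    obtain p q r where "b (u, u) = ereal p" "b (v, v) = ereal q" "b (u, v) = ereal r" "2 * r \<le> p + q"
      using real[of u v] zZ unfolding z by blast
    moreover have "b (v, u) = b (u, v)"
      using zZ sym unfolding z by auto
    ultimately show ?thesis
      unfolding z by (auto simp: two_point_factor_def)
  qed
  have attained: "?\<psi> (x, (x, y)) + ?\<psi> (y, (x, y)) = b (x, y)" if "(x, y) \<in> ?Z" for x y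
    using real[OF that] by (auto simp: two_point_factor_def)
  have "b (x, y) = (SUP z\<in>?Z. ?\<psi> (x, z) + ?\<psi> (y, z))" if xy: "x \<in> X" "y \<in> X" for x y
  proof (rule antisym)
    show "(SUP z\<in>?Z. ?\<psi> (x, z) + ?\<psi> (y, z)) \<le> b (x, y)"
      using below by (intro SUP_least)
    show "b (x, y) \<le> (SUP z\<in>?Z. ?\<psi> (x, z) + ?\<psi> (y, z))"
    proof (cases "b (x, y) = -\<infinity>")
      case False
      with xy have "(x, y) \<in> ?Z" by simp
      then show ?thesis
        by (rule SUP_upper2) (simp add: attained[OF \<open>(x, y) \<in> ?Z\<close>])
    qed simp
  qed
  then show ?thesis
    unfolding tropical_factorization_def using fin by blast
qed

(* HOL cannot quantify over types inside a formula, so "there exist a set Z" is rendered by an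
   equivalence with Z ranging over the subsets of a fixed type that is large enough, together with
   the implication from (ii) to (i) for Z of an arbitrary type 'z. *)
theorem proposition3p3:
  fixes X :: "'a set" and b :: "'a \<times> 'a \<Rightarrow> ereal"
  assumes "kernel_on X b"
  shows "(tpsd_on X b \<longleftrightarrow>
            (\<exists>(Z :: ('a \<times> 'a) set) \<psi>. tropical_factorization X b Z \<psi>))
       \<and> ((\<exists>(Z :: 'z set) \<psi>. tropical_factorization X b Z \<psi>) \<longrightarrow> tpsd_on X b)"
  using tropical_factorization_two_point_factor[of X b]
    tpsd_on_if_tropical_factorization[OF assms, where ?'b = "'a \<times> 'a"]
    tpsd_on_if_tropical_factorization[OF assms, where ?'b = 'z]
  by blast

end
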